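(* Let $b\ge2$ be an integer and let $c\ge2$ be real. Put $\alpha=\log_b c$ and $\rho=\{\alpha\}$. Define $y_n=n\alpha-\log_b(n+1)$ for integers $n\ge0$, and for integers $N\ge1$ $$B_{\alpha,b}(N)=\#\{0\le n<N:\{y_n\}\in[1-\rho,1)\},$$ with the interval interpreted as empty when $\rho=0$. Then $$A_{c,b}(N)=\log_b(N+1)+B_{\alpha,b}(N)-\rho N+\{y_N\}.$$ Consequently, if $D_{\alpha,b}(N)=B_{\alpha,b}(N)-\rho N$, then (i) $\mathcal S_{c,b}$ is infinite if and only if $\log_b(N+1)+D_{\alpha,b}(N)$ is unbounded (as $N$ varies); (ii) $A_{c,b}(N)\sim\log_bN$ if and only if $D_{\alpha,b}(N)=o(\log N)$; (iii) $\mathcal S_{c,b}$ is finite if and only if $D_{\alpha,b}(N)=-\log_b(N+1)+O(1)$.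
   Context: $\mathcal S_{c,b}$ is the set of integers $m\ge1$ for which there is an integer $k\ge0$ with $mb^k\le c^m<(m+1)b^k$, and $A_{c,b}(X)=\#(\mathcal S_{c,b}\cap[1,X])$. $\{x\}=x-\lfloor x\rfloor$. *)

theory Defs
  imports "HOL-Analysis.Analysis" "HOL-Library.Landau_Symbols"
begin

definition S_set :: "real \<Rightarrow> nat \<Rightarrow> nat set" where
  "S_set c b = {m. m \<ge> 1 \<and>
     (\<exists>k::nat. real m * real b ^ k \<le> c ^ m \<and> c ^ m < (real m + 1) * real b ^ k)}"

definition A_count :: "real \<Rightarrow> nat \<Rightarrow> real \<Rightarrow> nat" where
  "A_count c b X = card (S_set c b \<inter> {m. 1 \<le> real m \<and> real m \<le> X})"

definition y_seq :: "real \<Rightarrow> nat \<Rightarrow> nat \<Rightarrow> real" where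
  "y_seq \<alpha> b n = real n * \<alpha> - log (real b) (real n + 1)"

text \<open>When the fractional part of \<open>\<alpha>\<close> is zero the interval is \<open>{1..<1}\<close>, which is empty.\<close>

definition B_count :: "real \<Rightarrow> nat \<Rightarrow> nat \<Rightarrow> nat" where
  "B_count \<alpha> b N = card {n. n < N \<and> frac (y_seq \<alpha> b n) \<in> {1 - frac \<alpha>..<1}}"

definition D_disc :: "real \<Rightarrow> nat \<Rightarrow> nat \<Rightarrow> real" where
  "D_disc \<alpha> b N = real (B_count \<alpha> b N) - frac \<alpha> * real N"

end

theory Submission
  imports Defs
begin

text \<open>
  Write \<open>L x\<close> for the logarithm to base \<open>b\<close>. Taking logarithms, \<open>m\<close> lies in \<open>S_set c b\<close> iff some
  integer \<open>k\<close> satisfies \<open>m\<alpha> - L (m + 1) < k \<le> m\<alpha> - L m\<close>. The left end is \<open>y\<^sub>m\<close>, and the right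
  end is \<open>y\<^bsub>m-1\<^esub> + \<alpha>\<close>: the half-open interval joins two consecutive terms of the same sequence. Its
  length \<open>L ((m + 1) / m)\<close> is at most \<open>1\<close>, so it contains at most one integer, and the indicator of
  \<open>m \<in> S_set c b\<close> is \<open>\<lfloor>y\<^bsub>m-1\<^esub> + \<alpha>\<rfloor> - \<lfloor>y\<^sub>m\<rfloor>\<close> (lemma \<open>mem_S_set_indicator\<close>).

  On the other hand \<open>\<lfloor>y + \<alpha>\<rfloor>\<close> exceeds \<open>\<lfloor>y\<rfloor> + \<lfloor>\<alpha>\<rfloor>\<close> by the carry of the two fractional parts, which
  is exactly what \<open>B_count\<close> counts. Summing over \<open>m\<close>, the floors of \<open>y\<close> telescope and leave the
  integer identity \<open>A = B + N \<lfloor>\<alpha>\<rfloor> - \<lfloor>y\<^sub>N\<rfloor>\<close> (lemma \<open>A_count_floor_identity\<close>), which is the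
  claimed formula once \<open>\<lfloor>y\<^sub>N\<rfloor>\<close> is written as \<open>y\<^sub>N\<close> minus its fractional part.

  The three consequences hold because \<open>A\<close> and \<open>L (N + 1) + D\<close> then differ by a quantity in
  \<open>[0, 1)\<close>: a set of naturals is finite iff its counting function is bounded, and bounded errors
  disappear against \<open>ln N\<close>.
\<close>

section \<open>Membership as a difference of floors\<close>

text \<open>
  The size of \<open>c\<close> matters for this reason: \<open>c\<^sup>m \<ge> 2\<^sup>m \<ge> m + 1\<close> makes \<open>y\<^sub>m\<close> nonnegative, so
  an integer exponent beyond \<open>y\<^sub>m\<close> is automatically a natural number.
\<close>

lemma y_seq_nonneg:
  fixes b :: nat and c :: real
  assumes b: "b \<ge> 2" and c: "c \<ge> 2"
  shows "0 \<le> y_seq (log (real b) c) b m"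
proof -
  have "m + 1 \<le> 2 ^ m" using less_exp[of m] by linarith
  hence "real m + 1 \<le> 2 ^ m"
    by (metis of_nat_1 of_nat_add of_nat_le_iff of_nat_numeral of_nat_power)
  also have "\<dots> \<le> c ^ m" using c by (intro power_mono) auto
  finally have "log (real b) (real m + 1) \<le> log (real b) (c ^ m)"
    using b c by (subst log_le_cancel_iff) auto
  thus ?thesis using c by (simp add: y_seq_def log_nat_power)
qed

lemma y_seq_step:
  "y_seq \<alpha> b n + \<alpha> = real (Suc n) * \<alpha> - log (real b) (real (Suc n))"
  by (simp add: y_seq_def algebra_simps)

lemma mem_S_set_iff:
  fixes b :: nat and c :: real
  assumes b: "b \<ge> 2" and c: "c \<ge> 2" and "\<alpha> = log (real b) c"
  shows "Suc n \<in> S_set c b \<longleftrightarrow>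
    (\<exists>k::int. y_seq \<alpha> b (Suc n) < of_int k \<and> of_int k \<le> y_seq \<alpha> b n + \<alpha>)"
proof -
  define m where "m = Suc n"
  have m: "m \<ge> 1" by (simp add: m_def)
  have lower: "real m * real b ^ k \<le> c ^ m \<longleftrightarrow> real k \<le> y_seq \<alpha> b n + \<alpha>" for k :: nat
  proof -
    have "real m * real b ^ k \<le> c ^ m \<longleftrightarrow> log b (real m * real b ^ k) \<le> log b (c ^ m)"
      using b c m by (subst log_le_cancel_iff) auto
    also have "\<dots> \<longleftrightarrow> log b m + real k \<le> real m * \<alpha>"
      using b c m assms(3) by (simp add: log_mult log_nat_power)
    finally show ?thesis by (auto simp: y_seq_step m_def)
  qed
  have upper: "c ^ m < (real m + 1) * real b ^ k \<longleftrightarrow> y_seq \<alpha> b m < real k" for k :: nat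
  proof -
    have "c ^ m < (real m + 1) * real b ^ k \<longleftrightarrow> log b (c ^ m) < log b ((real m + 1) * real b ^ k)"
      using b c m by (subst log_less_cancel_iff) auto
    also have "\<dots> \<longleftrightarrow> real m * \<alpha> < log b (real m + 1) + real k"
      using b c m assms(3) by (simp add: log_mult log_nat_power)
    finally show ?thesis by (auto simp: y_seq_def)
  qed
  have "m \<in> S_set c b \<longleftrightarrow> (\<exists>k::nat. y_seq \<alpha> b m < real k \<and> real k \<le> y_seq \<alpha> b n + \<alpha>)"
    using m by (auto simp: S_set_def lower upper)
  also have "\<dots> \<longleftrightarrow> (\<exists>k::int. y_seq \<alpha> b m < of_int k \<and> of_int k \<le> y_seq \<alpha> b n + \<alpha>)"
  proof
    assume "\<exists>k::nat. y_seq \<alpha> b m < real k \<and> real k \<le> y_seq \<alpha> b n + \<alpha>"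
    thus "\<exists>k::int. y_seq \<alpha> b m < of_int k \<and> of_int k \<le> y_seq \<alpha> b n + \<alpha>"
      by (metis of_int_of_nat_eq)
  next
    assume "\<exists>k::int. y_seq \<alpha> b m < of_int k \<and> of_int k \<le> y_seq \<alpha> b n + \<alpha>"
    then obtain k :: int where k: "y_seq \<alpha> b m < of_int k" "of_int k \<le> y_seq \<alpha> b n + \<alpha>"
      by blast
    have "0 \<le> y_seq \<alpha> b m" using y_seq_nonneg[OF b c] assms(3) by simp
    hence "real (nat k) = of_int k" using k(1) by simp
    thus "\<exists>k::nat. y_seq \<alpha> b m < real k \<and> real k \<le> y_seq \<alpha> b n + \<alpha>"
      using k by metis
  qed
  finally show ?thesis by (simp add: m_def)
qed

lemma ex_int_in_short_interval_iff:
  fixes y z :: real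
  assumes "y \<le> z" "z \<le> y + 1"
  shows "of_bool (\<exists>k::int. y < of_int k \<and> of_int k \<le> z) = \<lfloor>z\<rfloor> - \<lfloor>y\<rfloor>"
proof (cases "\<lfloor>z\<rfloor> = \<lfloor>y\<rfloor>")
  case True
  have "\<not> (y < of_int k \<and> of_int k \<le> z)" for k :: int
    using True by (metis floor_less_iff le_floor_iff not_le)
  thus ?thesis using True by simp
next
  case False
  moreover have "\<lfloor>y\<rfloor> \<le> \<lfloor>z\<rfloor>" "\<lfloor>z\<rfloor> \<le> \<lfloor>y\<rfloor> + 1"
    using floor_mono[OF assms(1)] floor_mono[OF assms(2)] by simp_all
  ultimately have eq: "\<lfloor>z\<rfloor> = \<lfloor>y\<rfloor> + 1" by linarith
  hence "\<exists>k::int. y < of_int k \<and> of_int k \<le> z" by (intro exI[of _ "\<lfloor>z\<rfloor>"]) linarith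
  thus ?thesis using eq by simp
qed

text \<open>
  For \<open>m = Suc n\<close> the interval has length \<open>log b ((m + 1) / m) \<le> log b 2 \<le> 1\<close>. Equality occurs for \<open>b = 2\<close> and
  \<open>m = 1\<close>, which is harmless because the interval is half-open.
\<close>

lemma mem_S_set_indicator:
  fixes b :: nat and c :: real
  assumes b: "b \<ge> 2" and c: "c \<ge> 2" and \<alpha>: "\<alpha> = log (real b) c"
  shows "of_bool (Suc n \<in> S_set c b) = \<lfloor>y_seq \<alpha> b n + \<alpha>\<rfloor> - \<lfloor>y_seq \<alpha> b (Suc n)\<rfloor>"
proof -
  have ineq: "log b (real (Suc n)) \<le> log b (real (Suc n) + 1)"
    using b by (subst log_le_cancel_iff) auto
  have "log b (real (Suc n) + 1) \<le> log b (real b * real (Suc n))"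
  proof (subst log_le_cancel_iff)
    have "real (Suc n) + 1 \<le> 2 * real (Suc n)" by simp
    also have "\<dots> \<le> real b * real (Suc n)" using b by (intro mult_right_mono) auto
    finally show "real (Suc n) + 1 \<le> real b * real (Suc n)" .
  qed (use b in auto)
  also have "\<dots> = 1 + log b (real (Suc n))"
    using b by (subst log_mult) auto
  finally have "y_seq \<alpha> b n + \<alpha> \<le> y_seq \<alpha> b (Suc n) + 1"
    unfolding y_seq_step by (simp add: y_seq_def)
  moreover have "y_seq \<alpha> b (Suc n) \<le> y_seq \<alpha> b n + \<alpha>"
    unfolding y_seq_step using ineq by (simp add: y_seq_def)
  ultimately show ?thesis
    using ex_int_in_short_interval_iff mem_S_set_iff[OF assms] by auto
qed

section \<open>Telescoping\<close>

lemma floor_add_carry: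
  fixes x y :: real
  shows "\<lfloor>x + y\<rfloor> = \<lfloor>x\<rfloor> + \<lfloor>y\<rfloor> + of_bool (frac x \<in> {1 - frac y..<1})"
  using frac_lt_1[of x] by (auto simp: floor_add)

lemma B_count_Suc:
  "B_count \<alpha> b (Suc N) =
     B_count \<alpha> b N + of_bool (frac (y_seq \<alpha> b N) \<in> {1 - frac \<alpha>..<1})"
proof -
  let ?P = "\<lambda>n. frac (y_seq \<alpha> b n) \<in> {1 - frac \<alpha>..<1}"
  have "{n. n < Suc N \<and> ?P n} = (if ?P N then insert N {n. n < N \<and> ?P n} else {n. n < N \<and> ?P n})"
    by (auto simp: less_Suc_eq)
  thus ?thesis by (simp add: B_count_def)
qed

lemma A_count_eq_card: "A_count c b (real N) = card (S_set c b \<inter> {..N})"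
proof -
  have "S_set c b \<inter> {m. 1 \<le> real m \<and> real m \<le> real N} = S_set c b \<inter> {..N}"
    by (auto simp: S_set_def)
  thus ?thesis by (simp add: A_count_def)
qed

lemma A_count_Suc:
  "A_count c b (real (Suc N)) = A_count c b (real N) + of_bool (Suc N \<in> S_set c b)"
  by (simp only: A_count_eq_card atMost_Suc Int_insert_right) simp

lemma A_count_floor_identity:
  fixes b :: nat and c :: real
  assumes "b \<ge> 2" and "c \<ge> 2" and "\<alpha> = log (real b) c"
  shows "int (A_count c b (real N)) =
    int (B_count \<alpha> b N) + int N * \<lfloor>\<alpha>\<rfloor> - \<lfloor>y_seq \<alpha> b N\<rfloor>"
proof (induction N)
  case 0
  have "S_set c b \<inter> {..0} = {}" by (auto simp: S_set_def)
  thus ?case using A_count_eq_card[of c b 0] by (simp add: B_count_def y_seq_def)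
next
  case (Suc N)
  have "int (A_count c b (real (Suc N))) =
      int (A_count c b (real N)) + (\<lfloor>y_seq \<alpha> b N + \<alpha>\<rfloor> - \<lfloor>y_seq \<alpha> b (Suc N)\<rfloor>)"
    unfolding A_count_Suc mem_S_set_indicator[OF assms, symmetric] by simp
  thus ?case
    unfolding Suc floor_add_carry B_count_Suc by (simp add: algebra_simps)
qed

lemma A_count_formula:
  fixes b :: nat and c :: real
  assumes "b \<ge> 2" and "c \<ge> 2" and "\<alpha> = log (real b) c"
  shows "real (A_count c b (real N)) =
    log (real b) (real N + 1) + D_disc \<alpha> b N + frac (y_seq \<alpha> b N)"
proof -
  have "real (A_count c b (real N)) = of_int (int (A_count c b (real N)))" by simp
  also have "\<dots> = real (B_count \<alpha> b N) + real N * of_int \<lfloor>\<alpha>\<rfloor> - of_int \<lfloor>y_seq \<alpha> b N\<rfloor>"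
    unfolding A_count_floor_identity[OF assms] by simp
  finally show ?thesis
    by (simp add: D_disc_def frac_def y_seq_def algebra_simps)
qed

section \<open>Bounded errors\<close>

lemma finite_if_eventually_card_bounded:
  fixes S :: "nat set"
  assumes "\<forall>\<^sub>F N in sequentially. real (card (S \<inter> {..N})) \<le> K"
  shows "finite S"
proof (rule ccontr)
  assume inf: "infinite S"
  obtain M where M: "\<And>N. N \<ge> M \<Longrightarrow> real (card (S \<inter> {..N})) \<le> K"
    using assms by (auto simp: eventually_sequentially)
  obtain T where T: "T \<subseteq> S" "finite T" "card T = Suc (nat \<lceil>K\<rceil>)"
    using infinite_arbitrarily_large[OF inf] by blast
  obtain N where N: "T \<subseteq> {..N}" using T(2) finite_nat_iff_bounded_le by blast
  have "card T \<le> card (S \<inter> {..max M N})" using T(1) N by (intro card_mono) auto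
  moreover have "real (card (S \<inter> {..max M N})) \<le> K" by (intro M) simp
  ultimately show False using T(3) by linarith
qed

text \<open>
  Boundedness over all \<open>N \<ge> 1\<close> and boundedness for large \<open>N\<close> (the Landau condition) agree because
  a counting function is monotone, so an eventual bound is a bound everywhere.
\<close>

lemma finite_iff_bounded_perturbed_count:
  fixes S :: "nat set" and f :: "nat \<Rightarrow> real"
  assumes near: "\<And>N. \<bar>real (card (S \<inter> {..N})) - f N\<bar> \<le> K"
  shows "finite S \<longleftrightarrow> bounded (f ` {1..})" and "finite S \<longleftrightarrow> f \<in> O(\<lambda>_. 1)"
proof -
  have bdd: "\<bar>f N\<bar> \<le> real (card S) + K" if "finite S" for N
  proof -
    have "card (S \<inter> {..N}) \<le> card S" using that by (intro card_mono) auto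
    thus ?thesis using near[of N] by linarith
  qed
  have fin: "finite S" if "\<forall>\<^sub>F N in sequentially. \<bar>f N\<bar> \<le> C" for C
  proof (rule finite_if_eventually_card_bounded)
    show "\<forall>\<^sub>F N in sequentially. real (card (S \<inter> {..N})) \<le> C + K"
      using that
    proof eventually_elim
      case (elim N)
      thus ?case using near[of N] by linarith
    qed
  qed
  show "finite S \<longleftrightarrow> bounded (f ` {1..})"
  proof
    assume "finite S"
    thus "bounded (f ` {1..})" using bdd by (auto simp: bounded_iff)
  next
    assume "bounded (f ` {1..})"
    then obtain C where "\<forall>N\<ge>1. \<bar>f N\<bar> \<le> C" by (auto simp: bounded_iff)
    thus "finite S" by (intro fin[of C]) (auto simp: eventually_sequentially)
  qed
  show "finite S \<longleftrightarrow> f \<in> O(\<lambda>_. 1)"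
  proof
    assume "finite S"
    thus "f \<in> O(\<lambda>_. 1)" using bdd by (intro bigoI[where c = "real (card S) + K"]) auto
  next
    assume "f \<in> O(\<lambda>_. 1)"
    then obtain C where "\<forall>\<^sub>F N in sequentially. norm (f N) \<le> C * norm (1::real)"
      by (auto elim: landau_o.bigE)
    thus "finite S" by (intro fin[of C]) simp
  qed
qed

text \<open>
  Asymptotic equivalence with \<open>log b N\<close> means that the difference is \<open>o(ln N)\<close>, a condition that
  ignores an error \<open>e\<close> which is bounded for large \<open>N\<close>.
\<close>

lemma asymp_equiv_log_iff_smallo:
  fixes b :: nat and f d e :: "nat \<Rightarrow> real"
  assumes b: "b \<ge> 2" and e: "e \<in> O(\<lambda>_. 1)"
    and decomp: "\<And>N. f N - log (real b) (real N) = d N + e N"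
  shows "f \<sim>[at_top] (\<lambda>N. log (real b) (real N)) \<longleftrightarrow> d \<in> o(\<lambda>N. ln (real N))"
proof -
  have "(\<lambda>_. 1) \<in> o(\<lambda>N. ln (real N))"
    by (intro smalloI_tendsto tendsto_divide_0[OF tendsto_const] filterlim_at_top_imp_at_infinity
        filterlim_compose[OF ln_at_top filterlim_real_sequentially]
        eventually_sequentiallyI[of 2]) auto
  hence e': "e \<in> o(\<lambda>N. ln (real N))" using e landau_o.big_small_trans by blast
  have "(\<lambda>N. log (real b) (real N)) = (\<lambda>N. (1 / ln (real b)) * ln (real N))"
    by (simp add: log_def)
  hence "o(\<lambda>N. log (real b) (real N)) = o(\<lambda>N. ln (real N))"
    using b by simp
  hence "f \<sim>[at_top] (\<lambda>N. log (real b) (real N)) \<longleftrightarrow> (\<lambda>N. d N + e N) \<in> o(\<lambda>N. ln (real N))"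
    by (simp add: asymp_equiv_altdef decomp)
  also have "\<dots> \<longleftrightarrow> d \<in> o(\<lambda>N. ln (real N))"
    using sum_in_smallo[OF _ e'] by fastforce
  finally show ?thesis .
qed

section \<open>The counting formula and its consequences\<close>

theorem theorem4p1:
  fixes b :: nat and c \<alpha> \<rho> :: real
  assumes "b \<ge> 2" and "c \<ge> 2"
    and "\<alpha> = log (real b) c" and "\<rho> = frac \<alpha>"
  shows "(\<forall>N\<ge>1. real (A_count c b (real N)) =
            log (real b) (real N + 1) + real (B_count \<alpha> b N) - \<rho> * real N + frac (y_seq \<alpha> b N))
    \<and> (infinite (S_set c b) \<longleftrightarrow>
         \<not> bounded ((\<lambda>N::nat. log (real b) (real N + 1) + D_disc \<alpha> b N) ` {1..}))
    \<and> ((\<lambda>N::nat. real (A_count c b (real N))) \<sim>[at_top] (\<lambda>N. log (real b) (real N)) \<longleftrightarrow>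
         (\<lambda>N. D_disc \<alpha> b N) \<in> o(\<lambda>N. ln (real N)))
    \<and> (finite (S_set c b) \<longleftrightarrow>
         (\<lambda>N. D_disc \<alpha> b N - (- log (real b) (real N + 1))) \<in> O(\<lambda>_. 1))"
proof -
  let ?L = "log (real b)"
  note formula = A_count_formula[OF assms(1-3)]
  define f where "f N = ?L (real N + 1) + D_disc \<alpha> b N" for N
  have near: "\<bar>real (card (S_set c b \<inter> {..N})) - f N\<bar> \<le> 1" for N
    using formula[of N] frac_ge_0[of "y_seq \<alpha> b N"] frac_lt_1[of "y_seq \<alpha> b N"]
    by (simp add: A_count_eq_card f_def)
  have f_alt: "(\<lambda>N. D_disc \<alpha> b N - (- ?L (real N + 1))) = f"
    by (simp add: f_def fun_eq_iff)
  \<comment> \<open>In the asymptotic statement the reference is \<open>log b N\<close>, not \<open>log b (N + 1)\<close>; the shift adds an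
    error of at most \<open>1\<close> once \<open>N \<ge> 1\<close>.\<close>
  define e where "e N = ?L (real N + 1) - ?L (real N) + frac (y_seq \<alpha> b N)" for N
  have "\<bar>e N\<bar> \<le> 2" if N: "N \<ge> 1" for N
  proof -
    have "?L (real N) \<le> ?L (real N + 1)"
      using assms(1) N by (subst log_le_cancel_iff) auto
    moreover have "?L (real N + 1) \<le> ?L (real b * real N)"
    proof (subst log_le_cancel_iff)
      have "real N + 1 \<le> 2 * real N" using N by simp
      also have "\<dots> \<le> real b * real N" using assms(1) by (intro mult_right_mono) auto
      finally show "real N + 1 \<le> real b * real N" .
    qed (use assms(1) N in auto)
    moreover have "?L (real b * real N) = 1 + ?L (real N)"
      using assms(1) N by (subst log_mult) auto
    ultimately show ?thesis
      using frac_ge_0[of "y_seq \<alpha> b N"] frac_lt_1[of "y_seq \<alpha> b N"] by (simp add: e_def)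
  qed
  hence "e \<in> O(\<lambda>_. 1)"
    by (intro bigoI[where c = 2] eventually_sequentiallyI[of 1]) auto
  hence "(\<lambda>N. real (A_count c b (real N))) \<sim>[at_top] (\<lambda>N. ?L (real N)) \<longleftrightarrow>
      (\<lambda>N. D_disc \<alpha> b N) \<in> o(\<lambda>N. ln (real N))"
    by (rule asymp_equiv_log_iff_smallo[OF assms(1)]) (simp add: formula e_def)
  moreover have "finite (S_set c b) \<longleftrightarrow> bounded (f ` {1..})"
    and "finite (S_set c b) \<longleftrightarrow> f \<in> O(\<lambda>_. 1)"
    using finite_iff_bounded_perturbed_count[OF near] by auto
  moreover have "real (A_count c b (real N)) =
      ?L (real N + 1) + real (B_count \<alpha> b N) - \<rho> * real N + frac (y_seq \<alpha> b N)" for N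
    using formula[of N] by (simp add: D_disc_def assms(4))
  ultimately show ?thesis
    unfolding f_alt f_def[symmetric] by blast
qed

end
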